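(* Let $(\Omega,\mu)$ be a measure space, $\mathcal{H}_1,\mathcal{H}_2$ right quaternionic Hilbert spaces, $K_1\in\mathbb{B}(\mathcal{H}_1)$, $K_2\in\mathbb{B}(\mathcal{H}_2)$, and let $F_1:\Omega\to\mathcal{H}_1$, $F_2:\Omega\to\mathcal{H}_2$ be such that $F_1\oplus F_2:\Omega\to\mathcal{H}_1\oplus\mathcal{H}_2$ is a continuous $K_1\oplus K_2$-frame. If $G$ is a $K_1\oplus K_2$-dual mapping to $F_1\oplus F_2$ of the form $G=G_1\oplus G_2$, where $G_1\in\mathbb{B}(\mathcal{H}_1,L^2(\Omega,\mathbb{H}))$ and $G_2\in\mathbb{B}(\mathcal{H}_2,L^2(\Omega,\mathbb{H}))$, then $G_1$ is a $K_1$-dual mapping to $F_1$ and $G_2$ is a $K_2$-dual mapping to $F_2$.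
   Context: $\mathbb{H}$ denotes the quaternions. A right quaternionic Hilbert space is a right $\mathbb{H}$-vector space $\mathcal{H}$ with an inner product $\langle\cdot,\cdot\rangle:\mathcal{H}\times\mathcal{H}\to\mathbb{H}$ such that $\langle u,v\rangle=\overline{\langle v,u\rangle}$, $\langle v,v\rangle>0$ for $v\neq0$, additive in the second variable with $\langle v,uq\rangle=\langle v,u\rangle q$ for $q\in\mathbb{H}$, and complete for $\|u\|=\sqrt{\langle u,u\rangle}$. $\mathbb{B}(\mathcal{H},\mathcal{K})$ is the set of bounded right $\mathbb{H}$-linear operators from $\mathcal{H}$ to $\mathcal{K}$, $\mathbb{B}(\mathcal{H})=\mathbb{B}(\mathcal{H},\mathcal{H})$, $L^*$ is the adjoint of $L$. $L^2(\Omega,\mathbb{H})$ is the right quaternionic Hilbert space of measurable $g:\Omega\to\mathbb{H}$ with $\int_\Omega|g|^2d\mu<\infty$ (modulo a.e. equality), with $\langle g,h\rangle=\int_\Omega\overline{g(\omega)}h(\omega)\,d\mu(\omega)$. A weakly measurable $F:\Omega\to\mathcal{H}$ (i.e. $\omega\mapsto\langle F(\omega),u\rangle$ is measurable for each $u$) is a Bessel mapping if there is $0<B<\infty$ with $\int_\Omega|\langle F(\omega),u\rangle|^2d\mu(\omega)\leq B\|u\|^2$ for all $u\in\mathcal{H}$; for $K\in\mathbb{B}(\mathcal{H})$ it is a continuous $K$-frame for $\mathcal{H}$ if there are $0<A\leq B<\infty$ with $A\|K^*u\|^2\leq\int_\Omega|\langle F(\omega),u\rangle|^2d\mu(\omega)\leq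 B\|u\|^2$ for all $u$. The transform operator of a Bessel mapping is $\theta:\mathcal{H}\to L^2(\Omega,\mathbb{H})$, $\theta(u)(\omega)=\langle F(\omega),u\rangle$, and its pre-frame operator is $T=\theta^*:L^2(\Omega,\mathbb{H})\to\mathcal{H}$, $Tg=\int_\Omega F(\omega)g(\omega)\,d\mu(\omega)$ (weak sense). A $K$-dual mapping to a Bessel mapping $F$ is an $X\in\mathbb{B}(\mathcal{H},L^2(\Omega,\mathbb{H}))$ such that $K=TX$. $\mathcal{H}_1\oplus\mathcal{H}_2$ is the direct sum with inner product $\langle u_1\oplus v_1,u_2\oplus v_2\rangle=\langle u_1,u_2\rangle+\langle v_1,v_2\rangle$; $(K_1\oplus K_2)(u\oplus v)=K_1u\oplus K_2v$; $(F_1\oplus F_2)(\omega)=F_1(\omega)\oplus F_2(\omega)$. For $G_i\in\mathbb{B}(\mathcal{H}_i,L^2(\Omega,\mathbb{H}))$, the operator $G_1\oplus G_2\in\mathbb{B}(\mathcal{H}_1\oplus\mathcal{H}_2,L^2(\Omega,\mathbb{H}))$ is defined by $(G_1\oplus G_2)(u\oplus v)(\omega)=G_1u(\omega)+G_2v(\omega)$. *)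

theory Defs
  imports "HOL-Analysis.Analysis"
begin

section \<open>Quaternions\<close>

datatype quat = Quat (qre: real) (qi: real) (qj: real) (qk: real)

lemma quat_eq_iff: "x = y \<longleftrightarrow> qre x = qre y \<and> qi x = qi y \<and> qj x = qj y \<and> qk x = qk y"
  by (cases x; cases y) simp

instantiation quat :: ring_1
begin

definition "0 = Quat 0 0 0 0"
definition "1 = Quat 1 0 0 0"
definition "x + y = Quat (qre x + qre y) (qi x + qi y) (qj x + qj y) (qk x + qk y)"
definition "- x = Quat (- qre x) (- qi x) (- qj x) (- qk x)"
definition "x - y = Quat (qre x - qre y) (qi x - qi y) (qj x - qj y) (qk x - qk y)"
definition "x * y = Quat
  (qre x * qre y - qi x * qi y - qj x * qj y - qk x * qk y)
  (qre x * qi y + qi x * qre y + qj x * qk y - qk x * qj y)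
  (qre x * qj y - qi x * qk y + qj x * qre y + qk x * qi y)
  (qre x * qk y + qi x * qj y - qj x * qi y + qk x * qre y)"

instance
  by standard
    (simp_all add: zero_quat_def one_quat_def plus_quat_def uminus_quat_def minus_quat_def
      times_quat_def quat_eq_iff algebra_simps)

end

lemma quat_sel_simps [simp]:
  "qre 0 = 0" "qi 0 = 0" "qj 0 = 0" "qk 0 = 0"
  "qre 1 = 1" "qi 1 = 0" "qj 1 = 0" "qk 1 = 0"
  "qre (x + y) = qre x + qre y" "qi (x + y) = qi x + qi y"
  "qj (x + y) = qj x + qj y" "qk (x + y) = qk x + qk y"
  "qre (- x) = - qre x" "qi (- x) = - qi x" "qj (- x) = - qj x" "qk (- x) = - qk x"
  "qre (x - y) = qre x - qre y" "qi (x - y) = qi x - qi y"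
  "qj (x - y) = qj x - qj y" "qk (x - y) = qk x - qk y"
  "qre (x * y) = qre x * qre y - qi x * qi y - qj x * qj y - qk x * qk y"
  "qi (x * y) = qre x * qi y + qi x * qre y + qj x * qk y - qk x * qj y"
  "qj (x * y) = qre x * qj y - qi x * qk y + qj x * qre y + qk x * qi y"
  "qk (x * y) = qre x * qk y + qi x * qj y - qj x * qi y + qk x * qre y"
  by (simp_all add: zero_quat_def one_quat_def plus_quat_def uminus_quat_def minus_quat_def
      times_quat_def)

definition qcnj :: "quat \<Rightarrow> quat" where
  "qcnj x = Quat (qre x) (- qi x) (- qj x) (- qk x)"

lemma qcnj_sel [simp]:
  "qre (qcnj x) = qre x" "qi (qcnj x) = - qi x" "qj (qcnj x) = - qj x" "qk (qcnj x) = - qk x"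
  by (simp_all add: qcnj_def)

instantiation quat :: real_inner
begin

definition "scaleR r x = Quat (r * qre x) (r * qi x) (r * qj x) (r * qk x)"
definition "inner x y = qre x * qre y + qi x * qi y + qj x * qj y + qk x * qk y"
definition norm_quat_def_inner: "norm (x :: quat) = sqrt (inner x x)"
definition "sgn (x :: quat) = scaleR (inverse (norm x)) x"
definition "dist (x :: quat) y = norm (x - y)"
definition [code del]:
  "(uniformity :: (quat \<times> quat) filter) = (INF e\<in>{0 <..}. principal {(x, y). dist x y < e})"
definition [code del]:
  "open (U :: quat set) \<longleftrightarrow> (\<forall>x\<in>U. eventually (\<lambda>(x', y). x' = x \<longrightarrow> y \<in> U) uniformity)"

instance
proof
  fix x y z :: quat and r s :: real
  show "r *\<^sub>R (x + y) = r *\<^sub>R x + r *\<^sub>R y" "(r + s) *\<^sub>R x = r *\<^sub>R x + s *\<^sub>R x"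
    "r *\<^sub>R s *\<^sub>R x = (r * s) *\<^sub>R x" "1 *\<^sub>R x = x"
    by (simp_all add: scaleR_quat_def quat_eq_iff algebra_simps)
  show "inner x y = inner y x" "inner (x + y) z = inner x z + inner y z"
    "inner (r *\<^sub>R x) y = r * inner x y"
    by (simp_all add: inner_quat_def scaleR_quat_def algebra_simps)
  show "0 \<le> inner x x"
    by (simp add: inner_quat_def)
  show "inner x x = 0 \<longleftrightarrow> x = 0"
    using sum_power2_eq_zero_iff[of "qre x" "qi x"] sum_power2_eq_zero_iff[of "qj x" "qk x"]
      sum_power2_ge_zero[of "qre x" "qi x"] sum_power2_ge_zero[of "qj x" "qk x"]
    unfolding inner_quat_def quat_eq_iff quat_sel_simps power2_eq_square
    by (smt (verit))
  show "norm x = sqrt (inner x x)"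
    by (rule norm_quat_def_inner)
  show "sgn x = inverse (norm x) *\<^sub>R x" "dist x y = norm (x - y)"
    by (simp_all add: sgn_quat_def dist_quat_def)
  show "(uniformity :: (quat \<times> quat) filter) = (INF e\<in>{0 <..}. principal {(x, y). dist x y < e})"
    by (rule uniformity_quat_def)
  show "open U \<longleftrightarrow> (\<forall>x\<in>U. eventually (\<lambda>(x', y). x' = x \<longrightarrow> y \<in> U) uniformity)"
    for U :: "quat set"
    by (rule open_quat_def)
qed

end

lemma scaleR_quat_sel [simp]:
  "qre (r *\<^sub>R x) = r * qre x" "qi (r *\<^sub>R x) = r * qi x"
  "qj (r *\<^sub>R x) = r * qj x" "qk (r *\<^sub>R x) = r * qk x"
  by (simp_all add: scaleR_quat_def)

lemma norm_quat: "norm x = sqrt ((qre x)\<^sup>2 + (qi x)\<^sup>2 + (qj x)\<^sup>2 + (qk x)\<^sup>2)"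
  by (simp add: norm_quat_def_inner inner_quat_def power2_eq_square)

instantiation quat :: inverse
begin

definition "inverse x = scaleR (inverse ((norm x)\<^sup>2)) (qcnj x)"
definition "divide x (y :: quat) = x * inverse y"

instance ..

end

instance quat :: real_normed_div_algebra
proof
  fix x y :: quat and r :: real
  have sq: "(norm z)\<^sup>2 = (qre z)\<^sup>2 + (qi z)\<^sup>2 + (qj z)\<^sup>2 + (qk z)\<^sup>2" for z :: quat
    by (simp add: norm_quat)
  show "r *\<^sub>R x * y = r *\<^sub>R (x * y)" "x * r *\<^sub>R y = r *\<^sub>R (x * y)"
    by (simp_all add: quat_eq_iff algebra_simps)
  have c1: "qcnj z * z = (norm z)\<^sup>2 *\<^sub>R 1" "z * qcnj z = (norm z)\<^sup>2 *\<^sub>R 1" for z :: quat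
    unfolding quat_eq_iff scaleR_quat_sel sq by (simp_all add: power2_eq_square algebra_simps)
  have sc: "(r *\<^sub>R a) * b = r *\<^sub>R (a * b)" "a * (r *\<^sub>R b) = r *\<^sub>R (a * b)"
    for r and a b :: quat
    by (simp_all add: quat_eq_iff algebra_simps)
  show "x \<noteq> 0 \<Longrightarrow> inverse x * x = 1" "x \<noteq> 0 \<Longrightarrow> x * inverse x = 1"
    by (simp_all add: inverse_quat_def sc c1)
  show "x / y = x * inverse y"
    by (rule divide_quat_def)
  show "inverse (0 :: quat) = 0"
    by (simp add: inverse_quat_def)
  have cm: "qcnj (x * y) = qcnj y * qcnj x"
    by (simp add: quat_eq_iff)
  have "(norm (x * y))\<^sup>2 *\<^sub>R (1 :: quat) = x * (y * qcnj y) * qcnj x"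
    unfolding c1(2)[symmetric] cm by (simp only: mult.assoc)
  also have "\<dots> = (norm x * norm y)\<^sup>2 *\<^sub>R 1"
    by (simp add: c1(2) sc power_mult_distrib mult.commute)
  finally have "(norm (x * y))\<^sup>2 = (norm x * norm y)\<^sup>2"
    by (simp add: quat_eq_iff)
  then show "norm (x * y) = norm x * norm y"
    by (simp add: power2_eq_iff_nonneg)
qed

instantiation quat :: euclidean_space
begin

definition "Basis = {Quat 1 0 0 0, Quat 0 1 0 0, Quat 0 0 1 0, Quat 0 0 0 1}"

instance
proof
  show "(Basis :: quat set) \<noteq> {}" "finite (Basis :: quat set)"
    by (simp_all add: Basis_quat_def)
  show "inner u v = (if u = v then 1 else 0)" if "u \<in> Basis" "v \<in> Basis" for u v :: quat
    using that unfolding Basis_quat_def by (elim insertE emptyE) (simp_all add: inner_quat_def)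
  show "(\<forall>u\<in>Basis. inner x u = 0) \<longleftrightarrow> x = 0" for x :: quat
    by (simp add: Basis_quat_def inner_quat_def) (simp add: quat_eq_iff)
qed

end


section \<open>Right quaternionic Hilbert spaces\<close>

text \<open>
  A right quaternionic Hilbert space is in particular a complete real inner product space, with
  real inner product the real part of the quaternionic one. Extending \<^class>\<open>real_inner\<close> this way
  makes the library norm equal to \<open>sqrt \<langle>x, x\<rangle>\<close> and supplies positive definiteness;
  see \<open>qinner_self\<close> and \<open>qinner_self_pos\<close> below.
\<close>

class right_quat_hilbert = real_inner + complete_space +
  fixes scaleQ :: "'a \<Rightarrow> quat \<Rightarrow> 'a"
    and qinner :: "'a \<Rightarrow> 'a \<Rightarrow> quat"
  assumes scaleQ_add_left: "scaleQ (x + y) q = scaleQ x q + scaleQ y q"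
    and scaleQ_add_right: "scaleQ x (p + q) = scaleQ x p + scaleQ x q"
    and scaleQ_scaleQ: "scaleQ (scaleQ x p) q = scaleQ x (p * q)"
    and scaleQ_one: "scaleQ x 1 = x"
    and scaleR_conv_scaleQ: "scaleR r x = scaleQ x (of_real r)"
    and qinner_commute: "qinner x y = qcnj (qinner y x)"
    and qinner_add_right: "qinner x (y + z) = qinner x y + qinner x z"
    and qinner_scaleQ_right: "qinner x (scaleQ y q) = qinner x y * q"
    and inner_conv_qinner: "inner x y = qre (qinner x y)"

lemma of_real_quat_sel [simp]:
  "qre (of_real r) = r" "qi (of_real r) = 0" "qj (of_real r) = 0" "qk (of_real r) = 0"
  by (simp_all add: of_real_def)

lemma qinner_self: "qinner x x = of_real ((norm x)\<^sup>2)"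
proof -
  have "qinner x x = qcnj (qinner x x)"
    by (rule qinner_commute)
  then have "qi (qinner x x) = 0" "qj (qinner x x) = 0" "qk (qinner x x) = 0"
    by (simp_all add: quat_eq_iff)
  then show ?thesis
    by (simp add: quat_eq_iff inner_conv_qinner[symmetric] power2_norm_eq_inner)
qed

lemma qinner_self_pos: "x \<noteq> 0 \<Longrightarrow> \<exists>r>0. qinner x x = of_real r"
  by (auto simp: qinner_self intro!: exI[of _ "(norm x)\<^sup>2"])

instantiation prod :: (right_quat_hilbert, right_quat_hilbert) right_quat_hilbert
begin

definition "scaleQ x q = (scaleQ (fst x) q, scaleQ (snd x) q)"
definition "qinner x y = qinner (fst x) (fst y) + qinner (snd x) (snd y)"

instance
proof
  fix x y z :: "'a \<times> 'b" and p q :: quat and r :: real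
  show "scaleQ (x + y) q = scaleQ x q + scaleQ y q" "scaleQ x (p + q) = scaleQ x p + scaleQ x q"
    "scaleQ (scaleQ x p) q = scaleQ x (p * q)" "scaleQ x 1 = x"
    by (simp_all add: scaleQ_prod_def scaleQ_add_left scaleQ_add_right scaleQ_scaleQ scaleQ_one)
  show "r *\<^sub>R x = scaleQ x (of_real r)"
    by (simp add: scaleQ_prod_def scaleR_prod_def scaleR_conv_scaleQ)
  have "qcnj (a + b) = qcnj a + qcnj b" for a b
    by (simp add: quat_eq_iff)
  then show "qinner x y = qcnj (qinner y x)"
    by (simp add: qinner_prod_def qinner_commute[symmetric])
  show "qinner x (y + z) = qinner x y + qinner x z"
    by (simp add: qinner_prod_def qinner_add_right)
  show "qinner x (scaleQ y q) = qinner x y * q"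
    by (simp add: qinner_prod_def scaleQ_prod_def qinner_scaleQ_right distrib_right)
  show "inner x y = qre (qinner x y)"
    by (simp add: qinner_prod_def inner_prod_def inner_conv_qinner)
qed

end

definition bounded_qlinear ::
  "('a::right_quat_hilbert \<Rightarrow> 'b::right_quat_hilbert) \<Rightarrow> bool" where
  "bounded_qlinear K \<longleftrightarrow>
     (\<forall>u v. K (u + v) = K u + K v) \<and> (\<forall>u q. K (scaleQ u q) = scaleQ (K u) q) \<and>
     (\<exists>C. \<forall>u. norm (K u) \<le> C * norm u)"

definition qadjoint ::
  "('a::right_quat_hilbert \<Rightarrow> 'b::right_quat_hilbert) \<Rightarrow> 'b \<Rightarrow> 'a" where
  "qadjoint K v = (THE w. \<forall>u. qinner u w = qinner (K u) v)"


section \<open>The space of square-integrable quaternionic functions\<close>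

definition square_integrable :: "'w measure \<Rightarrow> ('w \<Rightarrow> quat) set" where
  "square_integrable M =
     {g \<in> borel_measurable M. (\<integral>\<^sup>+\<omega>. ennreal ((norm (g \<omega>))\<^sup>2) \<partial>M) < \<infinity>}"

definition l2_rel :: "'w measure \<Rightarrow> (('w \<Rightarrow> quat) \<times> ('w \<Rightarrow> quat)) set" where
  "l2_rel M = {(g, h). g \<in> square_integrable M \<and> h \<in> square_integrable M \<and>
     (AE \<omega> in M. g \<omega> = h \<omega>)}"

type_synonym 'w l2 = "('w \<Rightarrow> quat) set"

definition l2_class :: "'w measure \<Rightarrow> ('w \<Rightarrow> quat) \<Rightarrow> 'w l2" where
  "l2_class M g = l2_rel M `` {g}"

definition L2 :: "'w measure \<Rightarrow> 'w l2 set" where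
  "L2 M = square_integrable M // l2_rel M"

definition l2_add :: "'w measure \<Rightarrow> 'w l2 \<Rightarrow> 'w l2 \<Rightarrow> 'w l2" where
  "l2_add M Y Z = (\<Union>g\<in>Y. \<Union>h\<in>Z. l2_class M (\<lambda>\<omega>. g \<omega> + h \<omega>))"

definition l2_scaleQ :: "'w measure \<Rightarrow> 'w l2 \<Rightarrow> quat \<Rightarrow> 'w l2" where
  "l2_scaleQ M Y q = (\<Union>g\<in>Y. l2_class M (\<lambda>\<omega>. g \<omega> * q))"

definition l2_inner :: "'w measure \<Rightarrow> 'w l2 \<Rightarrow> 'w l2 \<Rightarrow> quat" where
  "l2_inner M Y Z = the_elem (\<Union>g\<in>Y. \<Union>h\<in>Z. {\<integral>\<omega>. qcnj (g \<omega>) * h \<omega> \<partial>M})"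

definition l2_norm :: "'w measure \<Rightarrow> 'w l2 \<Rightarrow> real" where
  "l2_norm M Y = sqrt (qre (l2_inner M Y Y))"

lemma equiv_l2_rel: "equiv (square_integrable M) (l2_rel M)"
proof (rule equivI)
  show "l2_rel M \<subseteq> square_integrable M \<times> square_integrable M"
    by (auto simp: l2_rel_def)
  show "refl_on (square_integrable M) (l2_rel M)"
    by (auto simp: refl_on_def l2_rel_def)
  show "sym (l2_rel M)"
    by (rule symI) (auto simp: l2_rel_def elim: eventually_mono)
  show "trans (l2_rel M)"
  proof (rule transI)
    fix x y z assume "(x, y) \<in> l2_rel M" "(y, z) \<in> l2_rel M"
    then have s: "x \<in> square_integrable M" "z \<in> square_integrable M"
      and "AE w in M. x w = y w" "AE w in M. y w = z w"
      by (auto simp: l2_rel_def)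
    from this(3,4) have "AE w in M. x w = z w"
      by eventually_elim simp
    with s show "(x, z) \<in> l2_rel M"
      by (simp add: l2_rel_def)
  qed
qed

lemma l2_class_in_L2: "g \<in> square_integrable M \<Longrightarrow> l2_class M g \<in> L2 M"
  by (simp add: l2_class_def L2_def quotientI)

lemma square_integrable_add:
  assumes "g \<in> square_integrable M" "h \<in> square_integrable M"
  shows "(\<lambda>\<omega>. g \<omega> + h \<omega>) \<in> square_integrable M"
proof -
  have m [measurable]: "g \<in> borel_measurable M" "h \<in> borel_measurable M"
    using assms by (auto simp: square_integrable_def)
  have "(norm (a + b))\<^sup>2 \<le> 2 * (norm a)\<^sup>2 + 2 * (norm b)\<^sup>2" for a b :: quat
  proof -
    have "(norm (a + b))\<^sup>2 \<le> (norm a + norm b)\<^sup>2"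
      by (simp add: norm_triangle_ineq power_mono)
    also have "\<dots> \<le> 2 * (norm a)\<^sup>2 + 2 * (norm b)\<^sup>2"
      using zero_le_power2[of "norm a - norm b"] by (simp add: power2_eq_square algebra_simps)
    finally show ?thesis .
  qed
  then have "ennreal ((norm (a + b))\<^sup>2) \<le> ennreal (2 * (norm a)\<^sup>2 + 2 * (norm b)\<^sup>2)" for a b :: quat
    by (rule ennreal_leI)
  moreover have "ennreal (2 * (norm a)\<^sup>2 + 2 * (norm b)\<^sup>2)
      = ennreal 2 * ennreal ((norm a)\<^sup>2) + ennreal 2 * ennreal ((norm b)\<^sup>2)" for a b :: quat
    by (simp add: ennreal_mult)
  ultimately have "ennreal ((norm (a + b))\<^sup>2)
      \<le> ennreal 2 * ennreal ((norm a)\<^sup>2) + ennreal 2 * ennreal ((norm b)\<^sup>2)" for a b :: quat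
    by metis
  then have "(\<integral>\<^sup>+\<omega>. ennreal ((norm (g \<omega> + h \<omega>))\<^sup>2) \<partial>M)
    \<le> (\<integral>\<^sup>+\<omega>. (ennreal 2 * ennreal ((norm (g \<omega>))\<^sup>2) + ennreal 2 * ennreal ((norm (h \<omega>))\<^sup>2)) \<partial>M)"
    by (intro nn_integral_mono)
  also have "\<dots> = ennreal 2 * (\<integral>\<^sup>+\<omega>. ennreal ((norm (g \<omega>))\<^sup>2) \<partial>M)
      + ennreal 2 * (\<integral>\<^sup>+\<omega>. ennreal ((norm (h \<omega>))\<^sup>2) \<partial>M)"
    by (simp add: nn_integral_add nn_integral_cmult)
  also have "\<dots> < \<infinity>"
    using assms by (auto simp: square_integrable_def ennreal_mult_less_top)
  finally show ?thesis
    by (simp add: square_integrable_def)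
qed

lemma square_integrable_scaleQ:
  assumes "g \<in> square_integrable M"
  shows "(\<lambda>\<omega>. g \<omega> * q) \<in> square_integrable M"
proof -
  have [measurable]: "g \<in> borel_measurable M"
    using assms by (auto simp: square_integrable_def)
  have "(\<integral>\<^sup>+\<omega>. ennreal ((norm (g \<omega> * q))\<^sup>2) \<partial>M)
      = (\<integral>\<^sup>+\<omega>. ennreal ((norm q)\<^sup>2) * ennreal ((norm (g \<omega>))\<^sup>2) \<partial>M)"
    by (simp add: norm_mult power_mult_distrib ennreal_mult mult.commute)
  also have "\<dots> = ennreal ((norm q)\<^sup>2) * (\<integral>\<^sup>+\<omega>. ennreal ((norm (g \<omega>))\<^sup>2) \<partial>M)"
    by (rule nn_integral_cmult) measurable
  also have "\<dots> < \<infinity>"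
    using assms by (auto simp: square_integrable_def ennreal_mult_less_top)
  finally show ?thesis
    by (simp add: square_integrable_def)
qed

lemma l2_add_class:
  assumes "g \<in> square_integrable M" "h \<in> square_integrable M"
  shows "l2_add M (l2_class M g) (l2_class M h) = l2_class M (\<lambda>\<omega>. g \<omega> + h \<omega>)"
proof -
  have "congruent2 (l2_rel M) (l2_rel M) (\<lambda>g h. l2_class M (\<lambda>\<omega>. g \<omega> + h \<omega>))"
  proof (rule congruent2I')
    fix g g' h h' assume a: "(g, g') \<in> l2_rel M" "(h, h') \<in> l2_rel M"
    then have "AE \<omega> in M. g \<omega> = g' \<omega>" "AE \<omega> in M. h \<omega> = h' \<omega>"
      by (auto simp: l2_rel_def)
    then have "AE \<omega> in M. g \<omega> + h \<omega> = g' \<omega> + h' \<omega>"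
      by eventually_elim simp
    with a have "((\<lambda>\<omega>. g \<omega> + h \<omega>), (\<lambda>\<omega>. g' \<omega> + h' \<omega>)) \<in> l2_rel M"
      by (auto simp: l2_rel_def square_integrable_add)
    then show "l2_class M (\<lambda>\<omega>. g \<omega> + h \<omega>) = l2_class M (\<lambda>\<omega>. g' \<omega> + h' \<omega>)"
      unfolding l2_class_def by (rule equiv_class_eq[OF equiv_l2_rel])
  qed
  from UN_equiv_class2[OF equiv_l2_rel equiv_l2_rel this assms] show ?thesis
    unfolding l2_add_def l2_class_def .
qed

lemma l2_scaleQ_class:
  assumes "g \<in> square_integrable M"
  shows "l2_scaleQ M (l2_class M g) q = l2_class M (\<lambda>\<omega>. g \<omega> * q)"
proof -
  have "congruent (l2_rel M) (\<lambda>g. l2_class M (\<lambda>\<omega>. g \<omega> * q))"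
  proof (rule congruentI)
    fix g g' assume a: "(g, g') \<in> l2_rel M"
    then have "AE \<omega> in M. g \<omega> = g' \<omega>"
      by (auto simp: l2_rel_def)
    then have "AE \<omega> in M. g \<omega> * q = g' \<omega> * q"
      by eventually_elim simp
    with a have "((\<lambda>\<omega>. g \<omega> * q), (\<lambda>\<omega>. g' \<omega> * q)) \<in> l2_rel M"
      by (auto simp: l2_rel_def square_integrable_scaleQ)
    then show "l2_class M (\<lambda>\<omega>. g \<omega> * q) = l2_class M (\<lambda>\<omega>. g' \<omega> * q)"
      unfolding l2_class_def by (rule equiv_class_eq[OF equiv_l2_rel])
  qed
  from UN_equiv_class[OF equiv_l2_rel this assms] show ?thesis
    unfolding l2_scaleQ_def l2_class_def .
qed

lemma borel_measurable_qcnj [measurable]: "qcnj \<in> borel_measurable borel"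
proof -
  have "linear qcnj"
    by (rule linearI) (simp_all add: quat_eq_iff)
  then have "bounded_linear qcnj"
    by (simp only: linear_conv_bounded_linear)
  then show ?thesis
    by (intro borel_measurable_continuous_onI linear_continuous_on)
qed

lemma l2_inner_class:
  assumes "g \<in> square_integrable M" "h \<in> square_integrable M"
  shows "l2_inner M (l2_class M g) (l2_class M h) = (\<integral>\<omega>. qcnj (g \<omega>) * h \<omega> \<partial>M)"
proof -
  have "congruent2 (l2_rel M) (l2_rel M) (\<lambda>g h. {\<integral>\<omega>. qcnj (g \<omega>) * h \<omega> \<partial>M})"
  proof (rule congruent2I')
    fix g g' h h' assume a: "(g, g') \<in> l2_rel M" "(h, h') \<in> l2_rel M"
    then have [measurable]: "g \<in> borel_measurable M" "g' \<in> borel_measurable M"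
      "h \<in> borel_measurable M" "h' \<in> borel_measurable M"
      by (auto simp: l2_rel_def square_integrable_def)
    from a have "AE \<omega> in M. g \<omega> = g' \<omega>" "AE \<omega> in M. h \<omega> = h' \<omega>"
      by (auto simp: l2_rel_def)
    then have "AE \<omega> in M. qcnj (g \<omega>) * h \<omega> = qcnj (g' \<omega>) * h' \<omega>"
      by eventually_elim simp
    then have "(\<integral>\<omega>. qcnj (g \<omega>) * h \<omega> \<partial>M) = (\<integral>\<omega>. qcnj (g' \<omega>) * h' \<omega> \<partial>M)"
      by (intro integral_cong_AE) measurable
    then show "{\<integral>\<omega>. qcnj (g \<omega>) * h \<omega> \<partial>M} = {\<integral>\<omega>. qcnj (g' \<omega>) * h' \<omega> \<partial>M}"
      by simp
  qed
  from UN_equiv_class2[OF equiv_l2_rel equiv_l2_rel this assms] show ?thesis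
    unfolding l2_inner_def l2_class_def by simp
qed

text \<open>Bounded right linear operators into the space of square-integrable functions, which is a
  carrier set rather than a type.\<close>

definition l2_bounded_qlinear ::
  "'w measure \<Rightarrow> ('a::right_quat_hilbert \<Rightarrow> 'w l2) \<Rightarrow> bool" where
  "l2_bounded_qlinear M X \<longleftrightarrow>
     (\<forall>u. X u \<in> L2 M) \<and>
     (\<forall>u v. X (u + v) = l2_add M (X u) (X v)) \<and>
     (\<forall>u q. X (scaleQ u q) = l2_scaleQ M (X u) q) \<and>
     (\<exists>C. \<forall>u. l2_norm M (X u) \<le> C * norm u)"

definition l2_osum ::
  "'w measure \<Rightarrow> ('a::right_quat_hilbert \<Rightarrow> 'w l2) \<Rightarrow> ('b::right_quat_hilbert \<Rightarrow> 'w l2) \<Rightarrow>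
     'a \<times> 'b \<Rightarrow> 'w l2" where
  "l2_osum M G1 G2 = (\<lambda>(u, v). l2_add M (G1 u) (G2 v))"


section \<open>Continuous K-frames and K-dual mappings\<close>

definition weakly_measurable ::
  "'w measure \<Rightarrow> ('w \<Rightarrow> 'a::right_quat_hilbert) \<Rightarrow> bool" where
  "weakly_measurable M F \<longleftrightarrow> (\<forall>u. (\<lambda>\<omega>. qinner (F \<omega>) u) \<in> borel_measurable M)"

definition bessel_mapping ::
  "'w measure \<Rightarrow> ('w \<Rightarrow> 'a::right_quat_hilbert) \<Rightarrow> bool" where
  "bessel_mapping M F \<longleftrightarrow> weakly_measurable M F \<and>
     (\<exists>B>0. \<forall>u. (\<integral>\<^sup>+\<omega>. ennreal ((norm (qinner (F \<omega>) u))\<^sup>2) \<partial>M) \<le> ennreal (B * (norm u)\<^sup>2))"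

definition continuous_K_frame ::
  "'w measure \<Rightarrow> ('a \<Rightarrow> 'a) \<Rightarrow> ('w \<Rightarrow> 'a::right_quat_hilbert) \<Rightarrow> bool" where
  "continuous_K_frame M K F \<longleftrightarrow> weakly_measurable M F \<and>
     (\<exists>A B. 0 < A \<and> A \<le> B \<and> (\<forall>u.
        ennreal (A * (norm (qadjoint K u))\<^sup>2)
          \<le> (\<integral>\<^sup>+\<omega>. ennreal ((norm (qinner (F \<omega>) u))\<^sup>2) \<partial>M) \<and>
        (\<integral>\<^sup>+\<omega>. ennreal ((norm (qinner (F \<omega>) u))\<^sup>2) \<partial>M) \<le> ennreal (B * (norm u)\<^sup>2)))"

definition transform_op ::
  "'w measure \<Rightarrow> ('w \<Rightarrow> 'a::right_quat_hilbert) \<Rightarrow> 'a \<Rightarrow> 'w l2" where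
  "transform_op M F u = l2_class M (\<lambda>\<omega>. qinner (F \<omega>) u)"

text \<open>The adjoint of the transform operator. By \<open>l2_inner_class\<close> the defining property reads
  \<open>\<langle>u, w\<rangle> = \<integral> \<langle>u, F \<omega>\<rangle> g \<omega> d\<mu>\<close> for a representative \<open>g\<close> of \<open>Y\<close>, that is, \<open>w\<close> is the weak integral
  of \<open>F \<omega> g \<omega>\<close>. It exists uniquely, by Riesz representation, if \<open>F\<close> is Bessel and
  \<open>Y \<in> L2 M\<close>.\<close>

definition preframe_op ::
  "'w measure \<Rightarrow> ('w \<Rightarrow> 'a::right_quat_hilbert) \<Rightarrow> 'w l2 \<Rightarrow> 'a" where
  "preframe_op M F Y = (THE w. \<forall>u. qinner u w = l2_inner M (transform_op M F u) Y)"

definition K_dual_mapping ::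
  "'w measure \<Rightarrow> ('a \<Rightarrow> 'a) \<Rightarrow> ('w \<Rightarrow> 'a::right_quat_hilbert) \<Rightarrow> ('a \<Rightarrow> 'w l2) \<Rightarrow> bool" where
  "K_dual_mapping M K F X \<longleftrightarrow>
     bessel_mapping M F \<and> l2_bounded_qlinear M X \<and> K = preframe_op M F \<circ> X"

end

theory Submission
  imports Defs
begin

text \<open>
  Testing against \<open>(u, 0)\<close> and \<open>(0, v)\<close> shows that the pre-frame operator of \<open>F\<^sub>1 \<oplus> F\<^sub>2\<close> acts
  componentwise, \<open>T Y = (T\<^sub>1 Y, T\<^sub>2 Y)\<close> (\<open>preframe_op_Pair\<close>): the transform operator of
  \<open>F\<^sub>1 \<oplus> F\<^sub>2\<close> sends \<open>(u, 0)\<close> to \<open>\<theta>\<^sub>1 u\<close> and \<open>(0, v)\<close> to \<open>\<theta>\<^sub>2 v\<close>. Since \<open>G\<^sub>2 0 = 0\<close>, the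
  hypothesis \<open>K\<^sub>1 \<oplus> K\<^sub>2 = T G\<close> at \<open>(u, 0)\<close> reads \<open>(K\<^sub>1 u, K\<^sub>2 0) = (T\<^sub>1 (G\<^sub>1 u), T\<^sub>2 (G\<^sub>1 u))\<close>,
  and the first component is the claim for \<open>G\<^sub>1\<close>. The argument at \<open>(0, v)\<close> is symmetric.

  The substance lies in the definition of \<open>T\<close> by a definite description: before anything can be
  read off from \<open>T Y\<close>, the weak integral that it denotes must be shown to exist. This is Riesz
  representation for the quaternionic functional \<open>u \<mapsto> \<langle>\<theta> u, Y\<rangle>\<close> (\<open>quaternionic_riesz\<close>). It
  reduces to the real theorem \<open>riesz_representation\<close>, because a quaternionic conjugate-linear
  functional is determined by its real part.
\<close>

section \<open>Riesz representation\<close>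

text \<open>
  The representing vector is the minimiser \<open>w\<close> of \<open>J x = \<langle>x, x\<rangle> - 2 \<phi> x\<close>: completing the square,
  \<open>J x = \<parallel>x - w\<parallel>\<^sup>2 - \<parallel>w\<parallel>\<^sup>2\<close> if \<open>w\<close> represents \<open>\<phi>\<close>. The parallelogram law makes every minimising
  sequence Cauchy, so that completeness yields \<open>w\<close>, and the vanishing of the first variation
  at \<open>w\<close> is the representation.
\<close>

theorem riesz_representation:
  fixes \<phi> :: "'a::{real_inner,complete_space} \<Rightarrow> real"
  assumes "bounded_linear \<phi>"
  shows "\<exists>w. \<forall>u. inner u w = \<phi> u"
proof -
  interpret bounded_linear \<phi> by fact
  define J where "J x = inner x x - 2 * \<phi> x" for x
  obtain C where C: "\<And>x. \<bar>\<phi> x\<bar> \<le> norm x * C"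
    using bounded by (auto simp: real_norm_def)
  have J_lower: "J x \<ge> - (C\<^sup>2)" for x
  proof -
    have "0 \<le> (norm x - C)\<^sup>2" by simp
    moreover have "\<phi> x \<le> norm x * C" using C[of x] by simp
    ultimately show ?thesis
      unfolding J_def power2_norm_eq_inner[symmetric] power2_diff by simp
  qed
  have bdd: "bdd_below (range J)"
    using J_lower by (intro bdd_belowI[of _ "- (C\<^sup>2)"]) auto
  define m where "m = Inf (range J)"
  have m_le: "m \<le> J x" for x
    unfolding m_def using bdd by (intro cInf_lower) auto
  have "\<exists>x. J x < m + 1 / real (Suc n)" for n
    using cInf_lessD[of "range J" "m + 1 / real (Suc n)"] unfolding m_def by auto
  then obtain x where x: "\<And>n. J (x n) < m + 1 / real (Suc n)" by metis
  have parallelogram: "(norm (a - b))\<^sup>2 \<le> 2 * (J a - m) + 2 * (J b - m)" for a b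
  proof -
    have "(norm (a - b))\<^sup>2 = 2 * J a + 2 * J b - 4 * J ((1/2) *\<^sub>R (a + b))"
      unfolding J_def power2_norm_eq_inner add scaleR
      by (simp add: algebra_simps inner_commute)
    then show ?thesis using m_le[of "(1/2) *\<^sub>R (a + b)"] by simp
  qed
  have "Cauchy x"
  proof (rule CauchyI)
    fix e :: real assume "e > 0"
    then obtain N where N: "1 / real (Suc N) < e\<^sup>2 / 4"
      using nat_approx_posE[of "e\<^sup>2 / 4"] by auto
    have small: "J (x n) - m < e\<^sup>2 / 4" if "n \<ge> N" for n
    proof -
      have "1 / real (Suc n) \<le> 1 / real (Suc N)"
        using that by (simp add: field_simps)
      then show ?thesis using x[of n] N by linarith
    qed
    have "norm (x i - x j) < e" if "i \<ge> N" "j \<ge> N" for i j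
    proof -
      have "(norm (x i - x j))\<^sup>2 \<le> 2 * (J (x i) - m) + 2 * (J (x j) - m)"
        by (rule parallelogram)
      also have "\<dots> < 2 * (e\<^sup>2 / 4) + 2 * (e\<^sup>2 / 4)"
        by (intro add_strict_mono mult_strict_left_mono small that) simp_all
      also have "\<dots> = e\<^sup>2" by simp
      finally have "(norm (x i - x j))\<^sup>2 < e\<^sup>2" .
      then show ?thesis using \<open>e > 0\<close> by (simp add: power2_less_imp_less)
    qed
    then show "\<exists>N. \<forall>i\<ge>N. \<forall>j\<ge>N. norm (x i - x j) < e" by blast
  qed
  then obtain w where w: "x \<longlonglongrightarrow> w"
    using Cauchy_convergent_iff convergent_def by blast
  have "(\<lambda>n. J (x n)) \<longlonglongrightarrow> J w"
    unfolding J_def by (intro tendsto_intros w tendsto)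
  moreover have "(\<lambda>n. m + 1 / real (Suc n)) \<longlonglongrightarrow> m + 0"
    by (intro tendsto_intros LIMSEQ_Suc lim_1_over_n)
  ultimately have "J w \<le> m + 0"
    by (rule LIMSEQ_le) (use x less_imp_le in blast)
  then have min: "J w \<le> J v" for v using m_le[of v] by simp
  have "inner u w = \<phi> u" for u
  proof (cases "u = 0")
    case True
    then show ?thesis by (simp add: zero)
  next
    case False
    define d where "d = \<phi> u - inner u w"
    have pos: "inner u u > 0" using False by simp
    \<comment> \<open>The step \<open>t\<close> along \<open>u\<close> that decreases the quadratic \<open>t \<mapsto> J (w + t u)\<close> most.\<close>
    define t where "t = d / inner u u"
    have "J (w + t *\<^sub>R u) = J w + (t * (t * inner u u) - 2 * t * d)"
      unfolding J_def add scaleR d_def by (simp add: algebra_simps inner_commute)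
    also have "t * inner u u = d" using pos by (simp add: t_def)
    finally have "t * d \<le> 0" using min[of "w + t *\<^sub>R u"] by (simp add: mult.commute)
    then have "d * d \<le> 0" using pos by (simp add: t_def divide_le_0_iff)
    then show ?thesis by (auto simp: d_def mult_le_0_iff)
  qed
  then show ?thesis by blast
qed

section \<open>Quaternionic inner products\<close>

lemma norm_qcnj [simp]: "norm (qcnj x) = norm x"
  by (simp add: norm_quat)

lemma abs_qre_le_norm: "\<bar>qre x\<bar> \<le> norm x"
  unfolding norm_quat by (rule real_le_rsqrt[THEN order_trans]) (auto simp: add.assoc)

lemma qcnj_add [simp]: "qcnj (x + y) = qcnj x + qcnj y"
  by (simp add: quat_eq_iff)

lemma qcnj_mult [simp]: "qcnj (x * y) = qcnj y * qcnj x"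
  by (simp add: quat_eq_iff)

lemma qinner_zero_right [simp]: "qinner x 0 = 0"
  using qinner_add_right[of x 0 0] by simp

lemma qinner_zero_left [simp]: "qinner 0 x = 0"
  using qinner_commute[of 0 x] by (simp add: quat_eq_iff)

lemma qinner_scaleQ_left: "qinner (scaleQ x q) y = qcnj q * qinner x y"
  by (metis qcnj_mult qinner_scaleQ_right qinner_commute)

lemma scaleQ_zero_right [simp]: "scaleQ (x::'a::right_quat_hilbert) 0 = 0"
  using scaleQ_add_right[of x 0 0] by simp

lemma qinner_Pair: "qinner (u, v) (w, z) = qinner u w + qinner v z"
  by (simp add: qinner_prod_def)

lemma qinner_right_ext:
  assumes "\<And>u. qinner u w = qinner u w'"
  shows "w = w'"
proof -
  have "inner (w - w') w = inner (w - w') w'"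
    by (simp only: inner_conv_qinner assms)
  then have "inner (w - w') (w - w') = 0"
    by (simp add: inner_diff_right)
  then show ?thesis by simp
qed

text \<open>
  The real parts of \<open>a\<close>, \<open>-i a\<close>, \<open>-j a\<close>, \<open>-k a\<close> are the four coordinates of \<open>a\<close>.
\<close>

lemma quat_eqI_qre_mult:
  assumes "\<And>q. qre (qcnj q * a) = qre (qcnj q * b)"
  shows "a = b"
  using assms[of 1] assms[of "Quat 0 1 0 0"] assms[of "Quat 0 0 1 0"] assms[of "Quat 0 0 0 1"]
  by (simp add: quat_eq_iff)

text \<open>
  Riesz representation over the reals gives a \<open>w\<close> with \<open>Re \<langle>u, w\<rangle> = Re (\<Lambda> u)\<close>. Both \<open>\<langle>u, w\<rangle>\<close> and
  \<open>\<Lambda> u\<close> are conjugate-linear in \<open>u\<close>, so replacing \<open>u\<close> by \<open>u q\<close> gives equality of the real parts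
  of all left multiples, hence of the quaternions themselves. The bound is asked for only
  on the unit ball, which is where the estimate of \<open>norm_integral_qcnj_mult_le\<close> can be used.
\<close>

theorem quaternionic_riesz:
  fixes \<Lambda> :: "'a::right_quat_hilbert \<Rightarrow> quat"
  assumes add: "\<And>u v. \<Lambda> (u + v) = \<Lambda> u + \<Lambda> v"
    and scale: "\<And>u q. \<Lambda> (scaleQ u q) = qcnj q * \<Lambda> u"
    and bound: "\<And>u. norm u \<le> 1 \<Longrightarrow> norm (\<Lambda> u) \<le> C"
  shows "\<exists>w. \<forall>u. qinner u w = \<Lambda> u"
proof -
  have scaleR: "\<Lambda> (r *\<^sub>R u) = r *\<^sub>R \<Lambda> u" for r u
    by (simp add: scaleR_conv_scaleQ scale quat_eq_iff)
  have "bounded_linear (\<lambda>u. qre (\<Lambda> u))"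
  proof (rule bounded_linear_intro)
    show "qre (\<Lambda> (u + v)) = qre (\<Lambda> u) + qre (\<Lambda> v)" for u v by (simp add: add)
    show "qre (\<Lambda> (r *\<^sub>R u)) = r *\<^sub>R qre (\<Lambda> u)" for r u by (simp add: scaleR)
    show "norm (qre (\<Lambda> u)) \<le> norm u * C" for u
    proof -
      have "\<Lambda> u = norm u *\<^sub>R \<Lambda> (sgn u)"
        unfolding scaleR[symmetric] by (cases "u = 0") (simp_all add: sgn_div_norm)
      then have "norm (\<Lambda> u) = norm u * norm (\<Lambda> (sgn u))" by simp
      also have "\<dots> \<le> norm u * C"
        by (intro mult_left_mono bound) (simp_all add: norm_sgn)
      finally show ?thesis using abs_qre_le_norm[of "\<Lambda> u"] by simp
    qed
  qed
  from riesz_representation[OF this] obtain w where w: "\<And>u. inner u w = qre (\<Lambda> u)" by blast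
  have "qinner u w = \<Lambda> u" for u
  proof (rule quat_eqI_qre_mult)
    show "qre (qcnj q * qinner u w) = qre (qcnj q * \<Lambda> u)" for q
      using w[of "scaleQ u q"] unfolding inner_conv_qinner qinner_scaleQ_left scale .
  qed
  then show ?thesis by blast
qed

section \<open>Square-integrable quaternionic functions\<close>

lemma L2_cases:
  assumes "Y \<in> L2 M"
  obtains y where "y \<in> square_integrable M" "Y = l2_class M y"
  using assms unfolding L2_def l2_class_def by (auto elim: quotientE)

lemma square_integrable_zero: "(\<lambda>_. 0) \<in> square_integrable M"
  by (simp add: square_integrable_def)

lemma square_integrable_measurable: "g \<in> square_integrable M \<Longrightarrow> g \<in> borel_measurable M"
  by (simp add: square_integrable_def)

lemma integrable_norm_square:
  assumes "g \<in> square_integrable M"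
  shows "integrable M (\<lambda>\<omega>. (norm (g \<omega>))\<^sup>2)"
  using assms unfolding square_integrable_def by (intro integrableI_bounded) auto

lemma norm_qcnj_mult_le: "norm (qcnj a * b) \<le> (norm a)\<^sup>2 + (norm b)\<^sup>2"
proof -
  have "0 \<le> (norm a - norm b)\<^sup>2" "0 \<le> norm a * norm b" by simp_all
  then show ?thesis unfolding norm_mult norm_qcnj power2_diff by linarith
qed

lemma integrable_qcnj_mult:
  assumes g: "g \<in> square_integrable M" and h: "h \<in> square_integrable M"
  shows "integrable M (\<lambda>\<omega>. qcnj (g \<omega>) * h \<omega>)"
proof (rule Bochner_Integration.integrable_bound)
  show "integrable M (\<lambda>\<omega>. (norm (g \<omega>))\<^sup>2 + (norm (h \<omega>))\<^sup>2)"
    using g h by (intro Bochner_Integration.integrable_add integrable_norm_square)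
  show "(\<lambda>\<omega>. qcnj (g \<omega>) * h \<omega>) \<in> borel_measurable M"
    using g[THEN square_integrable_measurable] h[THEN square_integrable_measurable] by measurable
  show "AE \<omega> in M. norm (qcnj (g \<omega>) * h \<omega>) \<le> norm ((norm (g \<omega>))\<^sup>2 + (norm (h \<omega>))\<^sup>2)"
    using norm_qcnj_mult_le by (auto intro: order_trans)
qed

text \<open>
  This crude substitute for the Cauchy-Schwarz inequality, from \<open>|a| |b| \<le> |a|\<^sup>2 + |b|\<^sup>2\<close>, still
  bounds a functional on the unit ball; homogeneity then takes care of the other vectors.
\<close>

lemma norm_integral_qcnj_mult_le:
  assumes g: "g \<in> square_integrable M" and h: "h \<in> square_integrable M"
  shows "norm (\<integral>\<omega>. qcnj (g \<omega>) * h \<omega> \<partial>M)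
    \<le> (\<integral>\<omega>. (norm (g \<omega>))\<^sup>2 \<partial>M) + (\<integral>\<omega>. (norm (h \<omega>))\<^sup>2 \<partial>M)"
proof -
  have "norm (\<integral>\<omega>. qcnj (g \<omega>) * h \<omega> \<partial>M)
      \<le> (\<integral>\<omega>. (norm (g \<omega>))\<^sup>2 + (norm (h \<omega>))\<^sup>2 \<partial>M)"
    using assms by (intro order_trans[OF integral_norm_bound] integral_mono integrable_norm
        integrable_qcnj_mult Bochner_Integration.integrable_add integrable_norm_square
        norm_qcnj_mult_le)
  then show ?thesis using assms by (simp add: integrable_norm_square)
qed

lemma l2_add_zero_right:
  assumes "Y \<in> L2 M"
  shows "l2_add M Y (l2_class M (\<lambda>_. 0)) = Y"
  using assms by (auto elim!: L2_cases simp: l2_add_class square_integrable_zero)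

lemma l2_add_zero_left:
  assumes "Y \<in> L2 M"
  shows "l2_add M (l2_class M (\<lambda>_. 0)) Y = Y"
  using assms by (auto elim!: L2_cases simp: l2_add_class square_integrable_zero)

lemma l2_bounded_qlinear_in_L2: "l2_bounded_qlinear M X \<Longrightarrow> X u \<in> L2 M"
  by (simp add: l2_bounded_qlinear_def)

lemma l2_bounded_qlinear_zero:
  assumes "l2_bounded_qlinear M X"
  shows "X 0 = l2_class M (\<lambda>_. 0)"
proof -
  obtain x where x: "x \<in> square_integrable M" "X 0 = l2_class M x"
    using L2_cases[OF l2_bounded_qlinear_in_L2[OF assms]] by metis
  have "X (scaleQ 0 0) = l2_scaleQ M (X 0) 0"
    using assms unfolding l2_bounded_qlinear_def by blast
  then show ?thesis
    using x by (simp add: l2_scaleQ_class)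
qed

section \<open>The pre-frame operator\<close>

lemma bessel_square_integrable:
  assumes "bessel_mapping M F"
  shows "(\<lambda>\<omega>. qinner (F \<omega>) u) \<in> square_integrable M"
proof -
  obtain B where "(\<integral>\<^sup>+\<omega>. ennreal ((norm (qinner (F \<omega>) u))\<^sup>2) \<partial>M) \<le> ennreal (B * (norm u)\<^sup>2)"
    using assms unfolding bessel_mapping_def by blast
  then have "(\<integral>\<^sup>+\<omega>. ennreal ((norm (qinner (F \<omega>) u))\<^sup>2) \<partial>M) < \<infinity>"
    using ennreal_less_top le_less_trans unfolding infinity_ennreal_def by blast
  then show ?thesis
    using assms unfolding bessel_mapping_def weakly_measurable_def square_integrable_def by auto
qed

theorem preframe_op_eqI:
  assumes "\<And>u. qinner u w = l2_inner M (transform_op M F u) Y"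
  shows "preframe_op M F Y = w"
  unfolding preframe_op_def
proof (rule the_equality)
  show "\<forall>u. qinner u w = l2_inner M (transform_op M F u) Y" using assms by blast
  show "w' = w" if "\<forall>u. qinner u w' = l2_inner M (transform_op M F u) Y" for w'
    using that assms by (intro qinner_right_ext) simp
qed

text \<open>
  The adjoint relation for \<open>T\<close> holds as soon as some vector satisfies it. Such a vector exists by
  Riesz representation, as the Bessel bound keeps \<open>u \<mapsto> \<integral> \<langle>u, F \<omega>\<rangle> y \<omega> d\<mu>\<close> bounded on the unit
  ball.
\<close>

theorem qinner_preframe_op:
  fixes F :: "'w \<Rightarrow> 'a::right_quat_hilbert"
  assumes F: "bessel_mapping M F" and Y: "Y \<in> L2 M"
  shows "qinner u (preframe_op M F Y) = l2_inner M (transform_op M F u) Y"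
proof -
  note SI = bessel_square_integrable[OF F]
  obtain y where y: "y \<in> square_integrable M" and Y_eq: "Y = l2_class M y"
    using L2_cases[OF Y] by metis
  define \<Lambda> where "\<Lambda> u = l2_inner M (transform_op M F u) Y" for u
  have \<Lambda>: "\<Lambda> u = (\<integral>\<omega>. qcnj (qinner (F \<omega>) u) * y \<omega> \<partial>M)" for u
    unfolding \<Lambda>_def transform_op_def Y_eq by (rule l2_inner_class[OF SI y])
  note int = integrable_qcnj_mult[OF SI y]
  obtain B where B: "B > 0"
    "\<And>u. (\<integral>\<^sup>+\<omega>. ennreal ((norm (qinner (F \<omega>) u))\<^sup>2) \<partial>M) \<le> ennreal (B * (norm u)\<^sup>2)"
    using F unfolding bessel_mapping_def by blast
  have "\<exists>w. \<forall>u. qinner u w = \<Lambda> u"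
  proof (rule quaternionic_riesz)
    show "\<Lambda> (u + v) = \<Lambda> u + \<Lambda> v" for u v
      unfolding \<Lambda> by (simp add: qinner_add_right distrib_right int)
    show "\<Lambda> (scaleQ u q) = qcnj q * \<Lambda> u" for u q
      unfolding \<Lambda> by (simp add: qinner_scaleQ_right mult.assoc int)
    show "norm (\<Lambda> u) \<le> B + (\<integral>\<omega>. (norm (y \<omega>))\<^sup>2 \<partial>M)" if "norm u \<le> 1" for u
    proof -
      have "ennreal (\<integral>\<omega>. (norm (qinner (F \<omega>) u))\<^sup>2 \<partial>M) \<le> ennreal (B * (norm u)\<^sup>2)"
        using B(2)[of u] by (simp add: nn_integral_eq_integral integrable_norm_square[OF SI])
      then have "(\<integral>\<omega>. (norm (qinner (F \<omega>) u))\<^sup>2 \<partial>M) \<le> B * (norm u)\<^sup>2"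
        using B(1) by (simp add: ennreal_le_iff)
      also have "\<dots> \<le> B"
        using that B(1) by (simp add: power_le_one mult_left_le)
      finally show ?thesis
        using norm_integral_qcnj_mult_le[OF SI y, of u] unfolding \<Lambda> by linarith
    qed
  qed
  then obtain w where w: "\<And>u. qinner u w = \<Lambda> u" by blast
  then have "preframe_op M F Y = w"
    unfolding \<Lambda>_def by (rule preframe_op_eqI)
  then show ?thesis using w by (simp add: \<Lambda>_def)
qed

section \<open>Direct sums\<close>

lemma transform_op_Pair_left: "transform_op M (\<lambda>\<omega>. (F1 \<omega>, F2 \<omega>)) (u, 0) = transform_op M F1 u"
  by (simp add: transform_op_def qinner_Pair)

lemma transform_op_Pair_right: "transform_op M (\<lambda>\<omega>. (F1 \<omega>, F2 \<omega>)) (0, v) = transform_op M F2 v"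
  by (simp add: transform_op_def qinner_Pair)

lemma bessel_mapping_Pair:
  assumes "bessel_mapping M (\<lambda>\<omega>. (F1 \<omega>, F2 \<omega>))"
  shows bessel_mapping_Pair_left: "bessel_mapping M F1"
    and bessel_mapping_Pair_right: "bessel_mapping M F2"
proof -
  from assms obtain B where
    meas: "\<And>x. (\<lambda>\<omega>. qinner (F1 \<omega>, F2 \<omega>) x) \<in> borel_measurable M" and "B > 0" and
    B: "\<And>x. (\<integral>\<^sup>+\<omega>. ennreal ((norm (qinner (F1 \<omega>, F2 \<omega>) x))\<^sup>2) \<partial>M) \<le> ennreal (B * (norm x)\<^sup>2)"
    unfolding bessel_mapping_def weakly_measurable_def by blast
  show "bessel_mapping M F1"
    unfolding bessel_mapping_def weakly_measurable_def
    using meas[of "(_, 0)"] B[of "(_, 0)"] \<open>B > 0\<close> by (auto simp: qinner_Pair)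
  show "bessel_mapping M F2"
    unfolding bessel_mapping_def weakly_measurable_def
    using meas[of "(0, _)"] B[of "(0, _)"] \<open>B > 0\<close> by (auto simp: qinner_Pair)
qed

text \<open>
  The weak integral of \<open>F\<^sub>1 \<oplus> F\<^sub>2\<close>, tested against \<open>(u, 0)\<close>, satisfies the relation that
  determines the weak integral of \<open>F\<^sub>1\<close>; likewise for \<open>F\<^sub>2\<close>.
\<close>

theorem preframe_op_Pair:
  assumes F: "bessel_mapping M (\<lambda>\<omega>. (F1 \<omega>, F2 \<omega>))" and Y: "Y \<in> L2 M"
  shows "preframe_op M (\<lambda>\<omega>. (F1 \<omega>, F2 \<omega>)) Y = (preframe_op M F1 Y, preframe_op M F2 Y)"
proof -
  obtain w1 w2 where w: "preframe_op M (\<lambda>\<omega>. (F1 \<omega>, F2 \<omega>)) Y = (w1, w2)"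
    by fastforce
  note spec = qinner_preframe_op[OF F Y, unfolded w]
  have "preframe_op M F1 Y = w1"
    using spec[of "(_, 0)"] by (intro preframe_op_eqI) (simp add: qinner_Pair transform_op_Pair_left)
  moreover have "preframe_op M F2 Y = w2"
    using spec[of "(0, _)"] by (intro preframe_op_eqI) (simp add: qinner_Pair transform_op_Pair_right)
  ultimately show ?thesis by (simp add: w)
qed

theorem theorem12:
  fixes M :: "'w measure"
    and K1 :: "'a::right_quat_hilbert \<Rightarrow> 'a" and K2 :: "'b::right_quat_hilbert \<Rightarrow> 'b"
    and F1 :: "'w \<Rightarrow> 'a" and F2 :: "'w \<Rightarrow> 'b"
    and G1 :: "'a \<Rightarrow> 'w l2" and G2 :: "'b \<Rightarrow> 'w l2" and G :: "'a \<times> 'b \<Rightarrow> 'w l2"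
  assumes "bounded_qlinear K1" and "bounded_qlinear K2"
    and "continuous_K_frame M (map_prod K1 K2) (\<lambda>\<omega>. (F1 \<omega>, F2 \<omega>))"
    and "K_dual_mapping M (map_prod K1 K2) (\<lambda>\<omega>. (F1 \<omega>, F2 \<omega>)) G"
    and "l2_bounded_qlinear M G1" and "l2_bounded_qlinear M G2"
    and "G = l2_osum M G1 G2"
  shows "K_dual_mapping M K1 F1 G1 \<and> K_dual_mapping M K2 F2 G2"
proof -
  note G1 = assms(5) and G2 = assms(6)
  from assms(4) have F: "bessel_mapping M (\<lambda>\<omega>. (F1 \<omega>, F2 \<omega>))"
    and K: "\<And>x. map_prod K1 K2 x = preframe_op M (\<lambda>\<omega>. (F1 \<omega>, F2 \<omega>)) (G x)"
    unfolding K_dual_mapping_def by (auto dest: fun_cong)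
  have "G (u, 0) = G1 u" for u
    using G1 G2 by (simp add: assms(7) l2_osum_def l2_bounded_qlinear_zero l2_add_zero_right
        l2_bounded_qlinear_in_L2)
  then have "K1 u = preframe_op M F1 (G1 u)" for u
    using K[of "(u, 0)"] by (simp add: preframe_op_Pair[OF F] l2_bounded_qlinear_in_L2[OF G1])
  moreover have "G (0, v) = G2 v" for v
    using G1 G2 by (simp add: assms(7) l2_osum_def l2_bounded_qlinear_zero l2_add_zero_left
        l2_bounded_qlinear_in_L2)
  then have "K2 v = preframe_op M F2 (G2 v)" for v
    using K[of "(0, v)"] by (simp add: preframe_op_Pair[OF F] l2_bounded_qlinear_in_L2[OF G2])
  ultimately show ?thesis
    using G1 G2 bessel_mapping_Pair[OF F] by (auto simp: K_dual_mapping_def)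
qed

end
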